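(* Let $X$ be a real Banach space and let $A:D(A)\to 2^X$ with $0\in Aq$ be uniformly accretive at zero with modulus $\Theta$. Let $(\alpha_i)$ be a sequence of nonnegative reals such that $\sum_{i=0}^\infty\alpha_i=\infty$ with rate of divergence $r$, and suppose that $(x_n)$ and $(u_n)$ are sequences satisfying $x_n\in D(A)$ and $$x_{n+1}=x_n-\alpha_n u_n,\qquad u_n\in Ax_{n+1}$$ for all $n\in\mathbb{N}$. Finally, let $K>0$ be such that $\|x_0-q\|<K$. Then $\|x_n-q\|\to 0$ with rate of convergence $$\Phi_{\Theta,r,K}(\varepsilon):=r\left(0,\frac{K^2}{\Theta_K(\varepsilon)}\right)+1 .$$
   Context: $\mathbb{N}=\{0,1,2,\ldots\}$. $X$ is a real Banach space with dual $X^\ast$; the normalized duality mapping $J:X\to 2^{X^\ast}$ is $J(x):=\{j\in X^\ast : \langle x,j\rangle=\|x\|^2=\|j\|^2\}$. An operator on $X$ is a mapping $A:X\to 2^X$, with domain $D(A):=\{x\in X: Ax\neq\emptyset\}$; $(x,u)\in A$ means $u\in Ax$. $A$ is accretive if for all $u\in Ax$ and $v\in Ay$ there exists $j\in J(x-y)$ with $\langle u-v,j\rangle\geq 0$. An accretive operator $A:D(A)\to 2^X$ with $0\in Aq$ is uniformly accretive at zero if for all $\varepsilon,K>0$ there exists $\delta>0$ such that $$(\ast)\quad \forall (x,u)\in A\ \big(\|x-q\|\in[\varepsilon,K]\to \exists j\in J(x-q)\ (\langle u,j\rangle\geq\delta)\big).$$ A function $\Theta_{(\cdot)}(\cdot):(0,\infty)\times(0,\infty)\to(0,\infty)$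 such that $\delta:=\Theta_K(\varepsilon)$ satisfies $(\ast)$ for all $\varepsilon,K>0$ is called a modulus of uniform accretivity at zero for $A$. A rate of convergence for a sequence of nonnegative reals $a_n\to 0$ is a function $\phi:(0,\infty)\to\mathbb{N}$ with $\forall\varepsilon>0\ \forall n\geq\phi(\varepsilon)\ (a_n\leq\varepsilon)$. A rate (or modulus) of divergence for $\sum_{i=0}^\infty\alpha_i=\infty$ (with $\alpha_i\ge 0$) is a function $r:\mathbb{N}\times(0,\infty)\to\mathbb{N}$ with $\sum_{i=N}^{r(N,x)}\alpha_i\geq x$ for all $N\in\mathbb{N}$, $x>0$, where $\sum_{i=N}^m\alpha_i=0$ if $m<N$. *)

theory Defs
  imports "HOL-Analysis.Analysis"
begin

text \<open>
  The dual of a real normed space is the type of bounded linear functionals with the operator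
  norm; the pairing of \<open>x\<close> with \<open>j\<close> is \<open>blinfun_apply j x\<close>.
\<close>

definition duality_map :: "'a::real_normed_vector \<Rightarrow> ('a \<Rightarrow>\<^sub>L real) set" where
  "duality_map x = {j. blinfun_apply j x = (norm x)\<^sup>2 \<and> (norm x)\<^sup>2 = (norm j)\<^sup>2}"

text \<open>
  A set-valued operator is a total function into sets, with \<open>A x = {}\<close> outside its domain.
\<close>

definition op_domain :: "('a \<Rightarrow> 'a set) \<Rightarrow> 'a set" where
  "op_domain A = {x. A x \<noteq> {}}"

definition accretive :: "('a::real_normed_vector \<Rightarrow> 'a set) \<Rightarrow> bool" where
  "accretive A \<longleftrightarrow>
    (\<forall>x y. \<forall>u\<in>A x. \<forall>v\<in>A y. \<exists>j\<in>duality_map (x - y). blinfun_apply j (u - v) \<ge> 0)"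

definition accretivity_bound ::
    "('a::real_normed_vector \<Rightarrow> 'a set) \<Rightarrow> 'a \<Rightarrow> real \<Rightarrow> real \<Rightarrow> real \<Rightarrow> bool" where
  "accretivity_bound A q \<epsilon> K \<delta> \<longleftrightarrow>
    (\<forall>x. \<forall>u\<in>A x. norm (x - q) \<in> {\<epsilon>..K} \<longrightarrow>
      (\<exists>j\<in>duality_map (x - q). blinfun_apply j u \<ge> \<delta>))"

definition uniformly_accretive_at_zero ::
    "('a::real_normed_vector \<Rightarrow> 'a set) \<Rightarrow> 'a \<Rightarrow> bool" where
  "uniformly_accretive_at_zero A q \<longleftrightarrow>
    accretive A \<and> 0 \<in> A q \<and>
    (\<forall>\<epsilon>>0. \<forall>K>0. \<exists>\<delta>>0. accretivity_bound A q \<epsilon> K \<delta>)"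

text \<open>
  Functions with domain \<open>(0, \<infinity>)\<close> are total functions on the reals whose values at nonpositive
  arguments are unconstrained. In \<open>\<Theta> K \<epsilon>\<close> the subscript \<open>K\<close> comes first.
\<close>

definition is_modulus_of_uniform_accretivity ::
    "('a::real_normed_vector \<Rightarrow> 'a set) \<Rightarrow> 'a \<Rightarrow> (real \<Rightarrow> real \<Rightarrow> real) \<Rightarrow> bool" where
  "is_modulus_of_uniform_accretivity A q \<Theta> \<longleftrightarrow>
    (\<forall>\<epsilon>>0. \<forall>K>0. \<Theta> K \<epsilon> > 0 \<and> accretivity_bound A q \<epsilon> K (\<Theta> K \<epsilon>))"

definition is_rate_of_convergence :: "(nat \<Rightarrow> real) \<Rightarrow> (real \<Rightarrow> nat) \<Rightarrow> bool" where
  "is_rate_of_convergence a \<phi> \<longleftrightarrow> (\<forall>\<epsilon>>0. \<forall>n\<ge>\<phi> \<epsilon>. a n \<le> \<epsilon>)"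

definition is_rate_of_divergence :: "(nat \<Rightarrow> real) \<Rightarrow> (nat \<Rightarrow> real \<Rightarrow> nat) \<Rightarrow> bool" where
  "is_rate_of_divergence \<alpha> r \<longleftrightarrow> (\<forall>N. \<forall>x>0. (\<Sum>i=N..r N x. \<alpha> i) \<ge> x)"

end

theory Submission
  imports Defs
begin

text \<open>
  Pairing the implicit step \<open>x (Suc n) - q = (x n - q) - \<alpha> n *\<^sub>R u n\<close> with a functional of the
  duality mapping at \<open>x (Suc n) - q\<close> shows that the squared distance to \<open>q\<close> drops by at least
  \<open>2 * \<alpha> n * \<Theta> K \<epsilon>\<close> as long as the new distance is at least \<open>\<epsilon>\<close>, while accretivity alone makes
  the distance nonincreasing. Since the squared distance starts below \<open>K\<^sup>2\<close>, the distance
  cannot stay above \<open>\<epsilon>\<close> until the step sizes have summed up to \<open>K\<^sup>2 / \<Theta> K \<epsilon>\<close>.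
\<close>

lemma duality_map_le:
  assumes "j \<in> duality_map x"
  shows "blinfun_apply j y \<le> norm x * norm y"
proof -
  have "norm j = norm x"
    using assms by (simp add: duality_map_def)
  then show ?thesis
    using norm_blinfun[of j y] by simp
qed

text \<open>Evaluate \<open>j\<close> on both sides of the second assumption: the left side gives
  the squared norm of \<open>y\<close>, and the term in \<open>z\<close> is bounded by the operator
  norm of \<open>j\<close>, which equals \<open>norm y\<close>.\<close>

lemma duality_map_step:
  fixes y z u :: "'a::real_normed_vector"
  assumes "j \<in> duality_map y" and "y = z - a *\<^sub>R u"
  shows "(norm y)\<^sup>2 \<le> norm y * norm z - a * blinfun_apply j u"
proof -
  have "(norm y)\<^sup>2 = blinfun_apply j y"
    using assms(1) by (simp add: duality_map_def)
  also have "\<dots> = blinfun_apply j z - a * blinfun_apply j u"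
    by (simp add: assms(2) blinfun.diff_right blinfun.scaleR_right)
  finally show ?thesis
    using duality_map_le[OF assms(1), of z] by simp
qed

lemma norm_duality_step_le:
  fixes y z u :: "'a::real_normed_vector"
  assumes "j \<in> duality_map y" and "y = z - a *\<^sub>R u"
    and "a \<ge> 0" and "blinfun_apply j u \<ge> 0"
  shows "norm y \<le> norm z"
proof (cases "y = 0")
  case False
  have "norm y * norm y \<le> norm y * norm z"
    using duality_map_step[OF assms(1,2)] mult_nonneg_nonneg[OF assms(3,4)]
    by (simp add: power2_eq_square)
  then show ?thesis
    using False by simp
qed simp

text \<open>The mixed product \<open>norm y * norm z\<close> is at most the mean of the two squares;
  clearing the half produces the factor 2.\<close>

lemma norm_duality_step_decrease:
  fixes y z u :: "'a::real_normed_vector"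
  assumes "j \<in> duality_map y" and "y = z - a *\<^sub>R u"
    and "a \<ge> 0" and "blinfun_apply j u \<ge> d"
  shows "(norm y)\<^sup>2 \<le> (norm z)\<^sup>2 - 2 * d * a"
proof -
  have "2 * (norm y * norm z) \<le> (norm y)\<^sup>2 + (norm z)\<^sup>2"
    using sum_squares_bound[of "norm y" "norm z"] by simp
  moreover have "d * a \<le> a * blinfun_apply j u"
    using mult_left_mono[OF assms(4,3)] by (simp add: mult.commute)
  ultimately show ?thesis
    using duality_map_step[OF assms(1,2)] by linarith
qed

lemma is_rate_of_convergence_imp_tendsto:
  assumes "is_rate_of_convergence a \<phi>" and "\<And>n. a n \<ge> 0"
  shows "a \<longlonglongrightarrow> 0"
proof (rule LIMSEQ_I)
  fix e :: real
  assume "e > 0"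
  \<comment> \<open>A rate gives only a non-strict bound, hence the argument
    \<open>e / 2\<close>.\<close>
  then have "a n \<le> e / 2" if "n \<ge> \<phi> (e / 2)" for n
    using assms(1) that half_gt_zero unfolding is_rate_of_convergence_def by blast
  then have "norm (a n - 0) < e" if "n \<ge> \<phi> (e / 2)" for n
    using that assms(2)[of n] \<open>e > 0\<close> by fastforce
  then show "\<exists>N. \<forall>n\<ge>N. norm (a n - 0) < e"
    by blast
qed

lemma telescoped_decrease:
  fixes b c :: "nat \<Rightarrow> real"
  assumes "\<And>i. i < n \<Longrightarrow> b (Suc i) \<le> b i - c i"
  shows "b n \<le> b 0 - (\<Sum>i<n. c i)"
  using assms by (induction n) fastforce+

theorem theorem4p2:
  fixes A :: "'a::banach \<Rightarrow> 'a set" and q :: 'a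
    and \<Theta> :: "real \<Rightarrow> real \<Rightarrow> real"
    and \<alpha> :: "nat \<Rightarrow> real" and r :: "nat \<Rightarrow> real \<Rightarrow> nat"
    and x u :: "nat \<Rightarrow> 'a" and K :: real
  assumes "uniformly_accretive_at_zero A q"
    and "is_modulus_of_uniform_accretivity A q \<Theta>"
    and "\<And>i. \<alpha> i \<ge> 0"
    and "filterlim (\<lambda>n. \<Sum>i<n. \<alpha> i) at_top sequentially"
    and "is_rate_of_divergence \<alpha> r"
    and "\<And>n. x n \<in> op_domain A"
    and "\<And>n. x (Suc n) = x n - \<alpha> n *\<^sub>R u n"
    and "\<And>n. u n \<in> A (x (Suc n))"
    and "K > 0"
    and "norm (x 0 - q) < K"
  shows "(\<lambda>n. norm (x n - q)) \<longlonglongrightarrow> 0 \<and>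
    is_rate_of_convergence (\<lambda>n. norm (x n - q)) (\<lambda>\<epsilon>. r 0 (K\<^sup>2 / \<Theta> K \<epsilon>) + 1)"
proof -
  let ?a = "\<lambda>n. norm (x n - q)"
  have step: "x (Suc n) - q = (x n - q) - \<alpha> n *\<^sub>R u n" for n
    by (simp add: assms(7))
  have "?a (Suc n) \<le> ?a n" for n
  proof -
    \<comment> \<open>Accretivity is applied to the pairs \<open>(x (Suc n), u n)\<close> and
      \<open>(q, 0)\<close>.\<close>
    from assms(1) assms(8)[of n] obtain j
      where "j \<in> duality_map (x (Suc n) - q)" "blinfun_apply j (u n - 0) \<ge> 0"
      unfolding uniformly_accretive_at_zero_def accretive_def by blast
    then show ?thesis
      using norm_duality_step_le[OF _ step assms(3)] by simp
  qed
  then have decr: "decseq ?a"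
    by (rule decseq_SucI)
  have "?a n \<le> \<epsilon>" if "\<epsilon> > 0" and n: "n \<ge> r 0 (K\<^sup>2 / \<Theta> K \<epsilon>) + 1" for \<epsilon> n
  proof (rule ccontr)
    assume "\<not> ?a n \<le> \<epsilon>"
    define N where "N = r 0 (K\<^sup>2 / \<Theta> K \<epsilon>)"
    define d where "d = \<Theta> K \<epsilon>"
    have d: "d > 0" "accretivity_bound A q \<epsilon> K d"
      using assms(2,9) \<open>\<epsilon> > 0\<close> unfolding is_modulus_of_uniform_accretivity_def d_def by auto
    have "(?a (Suc i))\<^sup>2 \<le> (?a i)\<^sup>2 - 2 * d * \<alpha> i" if "i < Suc N" for i
    proof -
      \<comment> \<open>Here \<open>Suc i\<close> \<le> \<open>Suc N\<close> \<le> \<open>n\<close>,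
        so monotonicity traps the distance between \<open>?a n\<close> > \<epsilon> and
        \<open>?a 0\<close> < \<open>K\<close>. The \<open>+ 1\<close> in the rate admits
        \<open>i = N\<close>, since step \<open>N\<close> produces \<open>x (Suc N)\<close>.\<close>
      have "?a n \<le> ?a (Suc i)" "?a (Suc i) \<le> ?a 0"
        using decr that n by (auto intro!: decseqD[of ?a] simp: N_def)
      then have "?a (Suc i) \<in> {\<epsilon>..K}"
        using \<open>\<not> ?a n \<le> \<epsilon>\<close> assms(10) by simp
      then obtain j where "j \<in> duality_map (x (Suc i) - q)" "blinfun_apply j (u i) \<ge> d"
        using d(2) assms(8)[of i] unfolding accretivity_bound_def by blast
      then show ?thesis
        using norm_duality_step_decrease[OF _ step assms(3)] by blast
    qed
    then have "(?a (Suc N))\<^sup>2 \<le> (?a 0)\<^sup>2 - (\<Sum>i<Suc N. 2 * d * \<alpha> i)"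
      by (rule telescoped_decrease[where b = "\<lambda>i. (?a i)\<^sup>2"])
    then have "2 * (d * (\<Sum>i<Suc N. \<alpha> i)) \<le> (?a 0)\<^sup>2"
      using zero_le_power2[of "?a (Suc N)"]
      unfolding sum_distrib_left[symmetric] mult.assoc by linarith
    moreover have "(?a 0)\<^sup>2 < K\<^sup>2"
      using assms(10) by (simp add: power_strict_mono)
    moreover have "K\<^sup>2 \<le> d * (\<Sum>i<Suc N. \<alpha> i)"
    proof -
      \<comment> \<open>The rate of divergence is specified only at positive arguments.\<close>
      have "K\<^sup>2 / d > 0"
        using assms(9) d(1) by simp
      then have "K\<^sup>2 / d \<le> (\<Sum>i=0..N. \<alpha> i)"
        using assms(5) unfolding is_rate_of_divergence_def N_def d_def by blast
      then show ?thesis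
        using d(1) by (simp add: pos_divide_le_eq mult.commute atLeast0AtMost lessThan_Suc_atMost
            del: sum.lessThan_Suc)
    qed
    \<comment> \<open>Together the three bounds give \<open>2 * K\<^sup>2 < K\<^sup>2\<close>,
      impossible for a square.\<close>
    ultimately show False
      using zero_le_power2[of K] by linarith
  qed
  then have "is_rate_of_convergence ?a (\<lambda>\<epsilon>. r 0 (K\<^sup>2 / \<Theta> K \<epsilon>) + 1)"
    unfolding is_rate_of_convergence_def by blast
  then show ?thesis
    using is_rate_of_convergence_imp_tendsto by auto
qed

end
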